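(* Let $\mathscr{E}$ be a quasi-potential multi-leader multi-follower game with associated functions $\phi_1,\dots,\phi_N$, $h$, $\pi$, and suppose $\varphi_i$ is a continuously differentiable function over $X\times Y$ for $i=1,\dots,N$. If $(x,w)$ is a local minimizer of $$\mathrm{P}^{\rm quasi}:\qquad \min_{(x',w')}\ \pi(x')+h(x',w')\quad\text{subject to}\quad (x',w')\in\mathcal{F}^{\rm quasi},$$ then $(x,y)$, where $y=(w,\dots,w)$ (i.e. $y_i=w$ for all $i\in\mathcal{N}$), is a local Nash equilibrium of $\mathscr{E}$.
   Context: Multi-leader multi-follower game $\mathscr{E}$: $\mathcal{N}=\{1,\dots,N\}$ is the set of leaders. Leader $i$ has a convex compact strategy set $X_i\subseteq\mathbb{R}^{m_i}$; $X=\prod_{i=1}^N X_i$. For $x=(x_1,\dots,x_N)$, $x^{-i}$ denotes $(x_1,\dots,x_{i-1},x_{i+1},\dots,x_N)$ and $(\bar x_i,x^{-i})$ denotes $x$ with $i$-th component replaced by $\bar x_i$. $Y$ is the ambient Euclidean space of follower strategy profiles. For each $x\in X$, the set of follower equilibria is $\mathcal{S}(x)\subseteq Y$, the (possibly multivalued, possibly empty) solution set of the variational inequality $\mathrm{VI}(G(x,\cdot),K(x))$, i.e. $\mathcal{S}(x)=\{y\in K(x): G(x,y)^\top(z-y)\ge 0\ \ \forall z\in K(x)\}$, where $K$ is a continuous set-valued map with closed convex values in $Y$ and $G$ is a continuous map of all its variables. Leader $i$ has a continuous objective $\varphi_i$ on $X\times Y$, written $\varphi_i(x_i,y_i;x^{-i})$,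 and (optimistic formulation) solves $$\mathrm{L}_i(x^{-i}):\quad \min_{x_i,y_i}\ \varphi_i(x_i,y_i;x^{-i})\quad\text{s.t. } x_i\in X_i,\ y_i\in\mathcal{S}(x).$$ Its feasible region is $\Omega_i(x^{-i})=\{(x_i,y_i): x_i\in X_i,\ y_i\in\mathcal{S}(x_i,x^{-i})\}$. Let $\mathcal{F}=\{(x,y): x_i\in X_i,\ y_i\in\mathcal{S}(x)\ \forall i\in\mathcal{N}\}$, with $y=(y_1,\dots,y_N)$. Local Nash equilibrium of $\mathscr{E}$: a point $(x,y)\in\mathcal{F}$ such that for all $i\in\mathcal{N}$, $(x_i,y_i)$ is a local minimum of $\mathrm{L}_i(x^{-i})$ (i.e. minimizes $\varphi_i(\cdot,\cdot;x^{-i})$ over the intersection of $\Omega_i(x^{-i})$ with some neighborhood of $(x_i,y_i)$). Quasi-potential game: $\mathscr{E}$ is quasi-potential if (i) there exist real-valued functions $\phi_1(x),\dots,\phi_N(x)$ on $X$ and a real-valued function $h$ on $X\times Y$ (the same for all leaders) such that $\varphi_i(x_i,y_i;x^{-i})=\phi_i(x)+h(x,y_i)$ for each $i$; and (ii) there is a function $\pi$ on $X$ such that for all $i$, all $x\in X$ and all $x_i'\in X_i$, $\phi_i(x_i;x^{-i})-\phi_i(x_i';x^{-i})=\pi(x_i;x^{-i})-\pi(x_i';x^{-i})$. $\mathcal{F}^{\rm quasi}=\{(x,w): x_i\in X_i\ \forall i\in\mathcal{N},\ w\in\mathcal{S}(x)\}$. *)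

theory Defs
  imports "HOL-Analysis.Analysis"
begin

text \<open>
  The finite type \<open>'n\<close> indexes the leaders, so \<open>N = CARD('n)\<close>. The components of a vector have one
  common type, so the spaces \<open>R^m_i\<close> of the individual leaders, whose dimensions may differ, are
  rendered as linear subspaces \<open>E i\<close> of a common Euclidean space \<open>'a\<close>, with \<open>m_i = dim (E i)\<close>.
  The space \<open>Y\<close> of follower strategy profiles is the whole type \<open>'b\<close>.
\<close>

definition replace_comp :: "'a ^ 'n \<Rightarrow> 'n \<Rightarrow> 'a \<Rightarrow> 'a ^ 'n" where
  "replace_comp x i v = (\<chi> j. if j = i then v else x $ j)"

definition profiles :: "('n \<Rightarrow> 'a set) \<Rightarrow> ('a ^ 'n) set" where
  "profiles X = {x. \<forall>i. x $ i \<in> X i}"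

text \<open>Continuity of a set-valued map on \<open>S\<close> in the sense of Berge: upper and lower semicontinuity.\<close>

definition set_valued_continuous_on ::
    "'c::topological_space set \<Rightarrow> ('c \<Rightarrow> 'd::topological_space set) \<Rightarrow> bool" where
  "set_valued_continuous_on S K \<longleftrightarrow>
     (\<forall>U. open U \<longrightarrow> openin (top_of_set S) {x \<in> S. K x \<subseteq> U}) \<and>
     (\<forall>U. open U \<longrightarrow> openin (top_of_set S) {x \<in> S. K x \<inter> U \<noteq> {}})"

text \<open>
  On a set that need not be open, \<open>C\<^sup>1\<close> means that some continuous \<open>f'\<close> provides derivatives relative
  to the set. Every function that is \<open>C\<^sup>1\<close> on an open neighbourhood of \<open>S\<close> has this property.
\<close>

definition continuously_differentiable_on ::
    "('c::real_normed_vector \<Rightarrow> real) \<Rightarrow> 'c set \<Rightarrow> bool" where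
  "continuously_differentiable_on f S \<longleftrightarrow>
     (\<exists>f' :: 'c \<Rightarrow> 'c \<Rightarrow>\<^sub>L real.
        (\<forall>z\<in>S. (f has_derivative blinfun_apply (f' z)) (at z within S)) \<and> continuous_on S f')"

definition local_minimizer :: "('c::topological_space \<Rightarrow> real) \<Rightarrow> 'c set \<Rightarrow> 'c \<Rightarrow> bool" where
  "local_minimizer f A z \<longleftrightarrow>
     z \<in> A \<and> (\<exists>U. open U \<and> z \<in> U \<and> (\<forall>u \<in> A \<inter> U. f z \<le> f u))"

definition VI_solutions :: "('b::real_inner \<Rightarrow> 'b) \<Rightarrow> 'b set \<Rightarrow> 'b set" where
  "VI_solutions F C = {y \<in> C. \<forall>z \<in> C. F y \<bullet> (z - y) \<ge> 0}"

definition follower_equilibria ::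
    "('a ^ 'n \<Rightarrow> 'b::real_inner set) \<Rightarrow> ('a ^ 'n \<Rightarrow> 'b \<Rightarrow> 'b) \<Rightarrow> 'a ^ 'n \<Rightarrow> 'b set" where
  "follower_equilibria K G x = VI_solutions (G x) (K x)"

text \<open>
  The leader objective \<open>\<phi>\<^sub>i(x\<^sub>i, y\<^sub>i; x\<^sup>-\<^sup>i)\<close> is written \<open>\<phi> i x y\<^sub>i\<close>, with the full profile \<open>x\<close> as argument.
\<close>

locale multi_leader_multi_follower_game =
  fixes E :: "'n::finite \<Rightarrow> 'a::euclidean_space set"
    and X :: "'n \<Rightarrow> 'a set"
    and K :: "'a ^ 'n \<Rightarrow> 'b::euclidean_space set"
    and G :: "'a ^ 'n \<Rightarrow> 'b \<Rightarrow> 'b"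
    and \<phi> :: "'n \<Rightarrow> 'a ^ 'n \<Rightarrow> 'b \<Rightarrow> real"
  assumes ambient_subspace: "\<And>i. subspace (E i)"
    and strategies_subset: "\<And>i. X i \<subseteq> E i"
    and strategies_convex: "\<And>i. convex (X i)"
    and strategies_compact: "\<And>i. compact (X i)"
    and K_continuous: "set_valued_continuous_on (profiles X) K"
    and K_closed_convex: "\<And>x. x \<in> profiles X \<Longrightarrow> closed (K x) \<and> convex (K x)"
    and G_continuous: "continuous_on (profiles X \<times> UNIV) (\<lambda>(x, y). G x y)"
    and objective_continuous: "\<And>i. continuous_on (profiles X \<times> UNIV) (\<lambda>(x, y). \<phi> i x y)"

text \<open>\<open>leader_feasible X S i x\<close> depends on \<open>x\<close> only through the components other than \<open>x $ i\<close>.\<close>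

definition leader_feasible ::
    "('n \<Rightarrow> 'a set) \<Rightarrow> ('a ^ 'n \<Rightarrow> 'b set) \<Rightarrow> 'n \<Rightarrow> 'a ^ 'n \<Rightarrow> ('a \<times> 'b) set" where
  "leader_feasible X S i x = {(v, u). v \<in> X i \<and> u \<in> S (replace_comp x i v)}"

definition game_feasible ::
    "('n \<Rightarrow> 'a set) \<Rightarrow> ('a ^ 'n \<Rightarrow> 'b set) \<Rightarrow> (('a ^ 'n) \<times> ('b ^ 'n)) set" where
  "game_feasible X S = {(x, y). \<forall>i. x $ i \<in> X i \<and> y $ i \<in> S x}"

definition local_Nash_equilibrium ::
    "('n \<Rightarrow> 'a::topological_space set) \<Rightarrow> ('a ^ 'n \<Rightarrow> 'b::topological_space set) \<Rightarrow>
     ('n \<Rightarrow> 'a ^ 'n \<Rightarrow> 'b \<Rightarrow> real) \<Rightarrow> 'a ^ 'n \<Rightarrow> 'b ^ 'n \<Rightarrow> bool" where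
  "local_Nash_equilibrium X S \<phi> x y \<longleftrightarrow>
     (x, y) \<in> game_feasible X S \<and>
     (\<forall>i. local_minimizer (\<lambda>(v, u). \<phi> i (replace_comp x i v) u)
            (leader_feasible X S i x) (x $ i, y $ i))"

definition quasi_potential ::
    "('n \<Rightarrow> 'a set) \<Rightarrow> ('n \<Rightarrow> 'a ^ 'n \<Rightarrow> 'b \<Rightarrow> real) \<Rightarrow>
     ('n \<Rightarrow> 'a ^ 'n \<Rightarrow> real) \<Rightarrow> ('a ^ 'n \<Rightarrow> 'b \<Rightarrow> real) \<Rightarrow> ('a ^ 'n \<Rightarrow> real) \<Rightarrow> bool" where
  "quasi_potential X \<phi> \<psi> h \<pi> \<longleftrightarrow>
     (\<forall>i. \<forall>x \<in> profiles X. \<forall>u. \<phi> i x u = \<psi> i x + h x u) \<and>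
     (\<forall>i. \<forall>x \<in> profiles X. \<forall>v \<in> X i.
        \<psi> i x - \<psi> i (replace_comp x i v) = \<pi> x - \<pi> (replace_comp x i v))"

definition quasi_feasible ::
    "('n \<Rightarrow> 'a set) \<Rightarrow> ('a ^ 'n \<Rightarrow> 'b set) \<Rightarrow> (('a ^ 'n) \<times> 'b) set" where
  "quasi_feasible X S = {(x, w). (\<forall>i. x $ i \<in> X i) \<and> w \<in> S x}"

end

theory Submission
  imports Defs
begin

text \<open>
  When leader \<open>i\<close> deviates from \<open>(x\<^sub>i, w)\<close> to \<open>(v, u)\<close> while the other leaders keep their strategies,
  the joint point \<open>(x, w)\<close> moves to \<open>(replace_comp x i v, u)\<close>. This embedding is continuous and
  carries the deviations feasible for leader \<open>i\<close> into the feasible set of the quasi-potential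
  problem, because the single follower component is then an equilibrium at the new profile. Along
  the embedding, the potential property makes \<open>\<phi> i\<close> and \<open>\<pi> + h\<close> change by the same amount
  (\<open>quasi_potential_difference\<close>). A local minimum of \<open>\<pi> + h\<close> therefore pulls back to a local minimum
  for each leader (\<open>local_minimizer_pullback\<close>). Sharing \<open>w\<close> among all leaders is what makes every
  leader's starting point map to the same \<open>(x, w)\<close>.
\<close>

lemma replace_comp_same [simp]: "replace_comp x i (x $ i) = x"
  by (simp add: replace_comp_def vec_eq_iff)

lemma replace_comp_in_profiles:
  assumes "x \<in> profiles X" and "v \<in> X i"
  shows "replace_comp x i v \<in> profiles X"
  using assms by (simp add: profiles_def replace_comp_def)

lemma continuous_on_replace_comp [continuous_intros]:
  assumes "continuous_on S f"
  shows "continuous_on S (\<lambda>z. replace_comp x i (f z))"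
  unfolding replace_comp_def
proof (rule continuous_on_vec_lambda)
  fix j
  show "continuous_on S (\<lambda>z. if j = i then f z else x $ j)"
    using assms by (cases "j = i") simp_all
qed

text \<open>
  The preimage under \<open>g\<close> of a neighbourhood on which \<open>g z\<close> is optimal is a neighbourhood of \<open>z\<close>.
  Only differences of objective values are compared, so the two objectives may differ by a constant
  along \<open>g\<close>; for a game this constant depends on the fixed strategies of the other leaders.
\<close>

lemma local_minimizer_pullback:
  assumes min: "local_minimizer f B (g z)"
    and cont: "continuous_on UNIV g"
    and z: "z \<in> A"
    and maps: "\<And>u. u \<in> A \<Longrightarrow> g u \<in> B"
    and diff: "\<And>u. u \<in> A \<Longrightarrow> f' u - f' z = f (g u) - f (g z)"
  shows "local_minimizer f' A z"
proof -
  obtain U where U: "open U" "g z \<in> U" "\<And>u. u \<in> B \<inter> U \<Longrightarrow> f (g z) \<le> f u"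
    using min unfolding local_minimizer_def by blast
  have "open (g -` U)"
    using open_vimage[OF U(1) cont] .
  moreover have "z \<in> g -` U"
    using U(2) by simp
  moreover have "f' z \<le> f' u" if "u \<in> A \<inter> g -` U" for u
    using U(3)[of "g u"] maps[of u] diff[of u] that by simp
  ultimately show ?thesis
    unfolding local_minimizer_def using z by blast
qed

lemma quasi_potential_difference:
  assumes "quasi_potential X \<phi> \<psi> h \<pi>" and "x \<in> profiles X" and "v \<in> X i"
  shows "\<phi> i (replace_comp x i v) u - \<phi> i x w
           = (\<pi> (replace_comp x i v) + h (replace_comp x i v) u) - (\<pi> x + h x w)"
proof -
  have "\<phi> i (replace_comp x i v) u = \<psi> i (replace_comp x i v) + h (replace_comp x i v) u"
    "\<phi> i x w = \<psi> i x + h x w"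
    "\<psi> i x - \<psi> i (replace_comp x i v) = \<pi> x - \<pi> (replace_comp x i v)"
    using assms replace_comp_in_profiles[of x X v i] by (simp_all add: quasi_potential_def)
  then show ?thesis
    by linarith
qed

theorem mainTheorem5:
  fixes E X :: "'n::finite \<Rightarrow> 'a::euclidean_space set"
    and K :: "'a ^ 'n \<Rightarrow> 'b::euclidean_space set"
    and G :: "'a ^ 'n \<Rightarrow> 'b \<Rightarrow> 'b"
    and \<phi> :: "'n \<Rightarrow> 'a ^ 'n \<Rightarrow> 'b \<Rightarrow> real"
    and \<psi> :: "'n \<Rightarrow> 'a ^ 'n \<Rightarrow> real"
    and h :: "'a ^ 'n \<Rightarrow> 'b \<Rightarrow> real"
    and \<pi> :: "'a ^ 'n \<Rightarrow> real"
    and x :: "'a ^ 'n" and w :: 'b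
  assumes "multi_leader_multi_follower_game E X K G \<phi>"
    and "quasi_potential X \<phi> \<psi> h \<pi>"
    and "\<And>i. continuously_differentiable_on (\<lambda>(x, y). \<phi> i x y) (profiles X \<times> UNIV)"
    and "local_minimizer (\<lambda>(x', w'). \<pi> x' + h x' w')
           (quasi_feasible X (follower_equilibria K G)) (x, w)"
  shows "local_Nash_equilibrium X (follower_equilibria K G) \<phi> x (\<chi> i. w)"
proof -
  let ?S = "follower_equilibria K G"
  have feas: "(x, w) \<in> quasi_feasible X ?S"
    using assms(4) by (simp add: local_minimizer_def)
  then have x: "x \<in> profiles X" and w: "w \<in> ?S x"
    by (simp_all add: quasi_feasible_def profiles_def)
  have "local_minimizer (\<lambda>(v, u). \<phi> i (replace_comp x i v) u)
          (leader_feasible X ?S i x) (x $ i, w)" for i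
  proof (rule local_minimizer_pullback[where g = "\<lambda>(v, u). (replace_comp x i v, u)"])
    show "local_minimizer (\<lambda>(x', w'). \<pi> x' + h x' w') (quasi_feasible X ?S)
            ((\<lambda>(v, u). (replace_comp x i v, u)) (x $ i, w))"
      using assms(4) by simp
    show "continuous_on UNIV (\<lambda>(v, u). (replace_comp x i v, u :: 'b))"
      unfolding case_prod_unfold by (intro continuous_intros)
    show "(x $ i, w) \<in> leader_feasible X ?S i x"
      using x w by (simp add: leader_feasible_def profiles_def)
  next
    fix p
    assume "p \<in> leader_feasible X ?S i x"
    then obtain v u where p: "p = (v, u)" and v: "v \<in> X i"
      and u: "u \<in> ?S (replace_comp x i v)"
      by (auto simp: leader_feasible_def)
    show "(\<lambda>(v, u). (replace_comp x i v, u)) p \<in> quasi_feasible X ?S"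
      using replace_comp_in_profiles[OF x v] u p by (simp add: quasi_feasible_def profiles_def)
    show "(\<lambda>(v, u). \<phi> i (replace_comp x i v) u) p
            - (\<lambda>(v, u). \<phi> i (replace_comp x i v) u) (x $ i, w)
          = (\<lambda>(x', w'). \<pi> x' + h x' w') ((\<lambda>(v, u). (replace_comp x i v, u)) p)
            - (\<lambda>(x', w'). \<pi> x' + h x' w') ((\<lambda>(v, u). (replace_comp x i v, u)) (x $ i, w))"
      using quasi_potential_difference[of X \<phi> \<psi> h \<pi> x v i u w] assms(2) x v p by simp
  qed
  moreover have "(x, \<chi> i. w) \<in> game_feasible X ?S"
    using x w by (simp add: game_feasible_def profiles_def)
  ultimately show ?thesis
    by (simp add: local_Nash_equilibrium_def)
qed

end
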